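(* Let $n\ge2$ and $\sigma\in S_n$. Then $\Gamma(\mathrm{Inv}(\sigma),\mathcal{U}^{col})=F_\sigma$, where $F_\sigma$ is the Stanley symmetric function of $\sigma$.
   Context: $\mathcal{A}=(G,\theta)$ is the valued digraph with vertex set $\lambda_n=\{(a,b)\in[n]^2:a<b\}$, an arc from $(a,b)$ to $(c,d)$ iff $(c,d)\in\{(a,k),(k,b)\}$ for some integer $a<k<b$, and $\theta(a,b)=b-a-1$. Peeling process on a valued digraph: repeatedly choose an erasable vertex $x_i$ (one with value $0$ such that every vertex with an arc into it has nonzero value), delete it with its incident arcs, and decrease by $1$ the value of each $y$ with an arc $(y,x_i)$. For a finite set $A$ of vertices, $PS_A(\mathcal{A})$ is the set of sequences $[z_1,\dots,z_{|A|}]$ enumerating $A$ that are the first $|A|$ terms of some peeling sequence of $\mathcal{A}$. $\mathcal{U}^{col}=(\mathcal{U}_{(a,b)})$ with $\mathcal{U}_{(a,b)}=\{(a,k):a<k\le n\}$. A function $f:A\to\mathbb{N}^*$ is $(A,\mathcal{U}^{col})$-semi-standard if some $[z_1,\dots,z_m]\in PS_A(\mathcal{A})$ satisfies for all $i<j$: $f(z_i)\le f(z_j)$, and $f(z_i)<f(z_j)$ if $z_j\in\mathcal{U}_{z_i}$; $\Gamma(A,\mathcal{U}^{col})=\sum_f\prod_{z\in A}x_{f(z)}$ over all such $f$. $\mathrm{Inv}(\sigma)=\{(a,b):a<b,\ \sigma^{-1}(a)>\sigma^{-1}(b)\}$. With $s_i=(i\ i+1)$ and $\ell$ the length, $\mathrm{Red}(\sigma)$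 is the set of sequences $(i_1,\dots,i_{\ell(\sigma)})$ with $\sigma=s_{i_1}\cdots s_{i_{\ell(\sigma)}}$, and $F_\sigma=\sum_{(i_1,\dots,i_{\ell(\sigma)})\in\mathrm{Red}(\sigma)}\sum x_{r_1}\cdots x_{r_{\ell(\sigma)}}$, the inner sum over positive integers $r_1\le\dots\le r_{\ell(\sigma)}$ with $r_j<r_{j+1}$ whenever $i_j<i_{j+1}$. *)

theory Defs
  imports
    "Graph_Theory.Pair_Digraph"
    "HOL-Library.Poly_Mapping"
    "HOL-Library.FuncSet"
    "HOL-Combinatorics.Permutations"
begin

record 'a valued_digraph = "'a pair_pre_digraph" +
  theta :: "'a \<Rightarrow> int"

definition erasable :: "'a valued_digraph \<Rightarrow> 'a \<Rightarrow> bool" where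
  "erasable D x \<longleftrightarrow> x \<in> pverts D \<and> theta D x = 0 \<and>
     (\<forall>y\<in>pverts D. (y, x) \<in> parcs D \<longrightarrow> theta D y \<noteq> 0)"

definition erase :: "'a valued_digraph \<Rightarrow> 'a \<Rightarrow> 'a valued_digraph" where
  "erase D x =
     \<lparr> pverts = pverts D - {x},
       parcs = {(y, z) \<in> parcs D. y \<noteq> x \<and> z \<noteq> x},
       theta = (\<lambda>y. if (y, x) \<in> parcs D then theta D y - 1 else theta D y) \<rparr>"

text \<open>The process is run until no erasable vertex is left; all digraphs considered are finite,
  so that peeling sequences are lists.\<close>

fun peeling_sequence :: "'a valued_digraph \<Rightarrow> 'a list \<Rightarrow> bool" where
  "peeling_sequence D [] \<longleftrightarrow> (\<nexists>x. erasable D x)"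
| "peeling_sequence D (x # xs) \<longleftrightarrow> erasable D x \<and> peeling_sequence (erase D x) xs"

definition PS :: "'a valued_digraph \<Rightarrow> 'a set \<Rightarrow> 'a list set" where
  "PS D A = {zs. distinct zs \<and> set zs = A \<and>
     (\<exists>L. peeling_sequence D L \<and> card A \<le> length L \<and> zs = take (card A) L)}"

text \<open>For the variables \<open>x\<^sub>1, x\<^sub>2, \<dots>\<close>, polynomials are finitely supported maps from exponent vectors to coefficients; a formal power
  series is an arbitrary such map. The (possibly infinite) sum of a family of polynomials is taken
  coefficientwise. It is meaningful when each monomial occurs in finitely many members; this is
  shown below for all families that are used.\<close>

type_synonym mpoly = "(nat \<Rightarrow>\<^sub>0 nat) \<Rightarrow>\<^sub>0 int"
type_synonym mseries = "(nat \<Rightarrow>\<^sub>0 nat) \<Rightarrow> int"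

definition X :: "nat \<Rightarrow> mpoly" where
  "X i = Poly_Mapping.single (Poly_Mapping.single i 1) 1"

definition formal_sum :: "('i \<Rightarrow> mpoly) \<Rightarrow> 'i set \<Rightarrow> mseries" where
  "formal_sum p I =
     (\<lambda>m. \<Sum>i\<in>{i \<in> I. Poly_Mapping.lookup (p i) m \<noteq> 0}. Poly_Mapping.lookup (p i) m)"

text \<open>Functions on \<open>A\<close> are extensional, so that each of them is counted once.\<close>

definition semistandard ::
  "'a valued_digraph \<Rightarrow> ('a \<Rightarrow> 'a set) \<Rightarrow> 'a set \<Rightarrow> ('a \<Rightarrow> nat) \<Rightarrow> bool" where
  "semistandard D U A f \<longleftrightarrow> f \<in> A \<rightarrow>\<^sub>E {0<..} \<and>
     (\<exists>zs\<in>PS D A. \<forall>i j. i < j \<longrightarrow> j < length zs \<longrightarrow>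
        f (zs ! i) \<le> f (zs ! j) \<and> (zs ! j \<in> U (zs ! i) \<longrightarrow> f (zs ! i) < f (zs ! j)))"

definition Gamma_series :: "'a valued_digraph \<Rightarrow> ('a \<Rightarrow> 'a set) \<Rightarrow> 'a set \<Rightarrow> mseries" where
  "Gamma_series D U A = formal_sum (\<lambda>f. \<Prod>z\<in>A. X (f z)) {f. semistandard D U A f}"

definition lam :: "nat \<Rightarrow> (nat \<times> nat) set" where
  "lam n = {(a, b). a \<in> {1..n} \<and> b \<in> {1..n} \<and> a < b}"

definition digraph_A :: "nat \<Rightarrow> (nat \<times> nat) valued_digraph" where
  "digraph_A n =
     \<lparr> pverts = lam n,
       parcs = {((a, b), (c, d)) | a b c d. (a, b) \<in> lam n \<and> (c, d) \<in> lam n \<and>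
                  (\<exists>k. a < k \<and> k < b \<and> (c, d) \<in> {(a, k), (k, b)})},
       theta = (\<lambda>(a, b). int b - int a - 1) \<rparr>"

definition U_col :: "nat \<Rightarrow> nat \<times> nat \<Rightarrow> (nat \<times> nat) set" where
  "U_col n = (\<lambda>(a, b). {(a, k) | k. a < k \<and> k \<le> n})"

definition Inv :: "nat \<Rightarrow> (nat \<Rightarrow> nat) \<Rightarrow> (nat \<times> nat) set" where
  "Inv n \<sigma> = {(a, b). a \<in> {1..n} \<and> b \<in> {1..n} \<and> a < b \<and> inv \<sigma> a > inv \<sigma> b}"

text \<open>Products of permutations are compositions of functions, the rightmost factor being
  applied first.\<close>

definition word_perm :: "nat list \<Rightarrow> nat \<Rightarrow> nat" where
  "word_perm w = foldr (\<lambda>i g. Transposition.transpose i (i + 1) \<circ> g) w id"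

definition words_of :: "nat \<Rightarrow> (nat \<Rightarrow> nat) \<Rightarrow> nat list set" where
  "words_of n \<sigma> = {w. set w \<subseteq> {1..<n} \<and> word_perm w = \<sigma>}"

definition len :: "nat \<Rightarrow> (nat \<Rightarrow> nat) \<Rightarrow> nat" where
  "len n \<sigma> = (LEAST l. \<exists>w\<in>words_of n \<sigma>. length w = l)"

definition Red :: "nat \<Rightarrow> (nat \<Rightarrow> nat) \<Rightarrow> nat list set" where
  "Red n \<sigma> = {w \<in> words_of n \<sigma>. length w = len n \<sigma>}"

definition compatible :: "nat list \<Rightarrow> nat list set" where
  "compatible w = {r. length r = length w \<and> set r \<subseteq> {0<..} \<and> sorted r \<and>
     (\<forall>j. Suc j < length w \<longrightarrow> w ! j < w ! Suc j \<longrightarrow> r ! j < r ! Suc j)}"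

definition stanley :: "nat \<Rightarrow> (nat \<Rightarrow> nat) \<Rightarrow> mseries" where
  "stanley n \<sigma> =
     (\<lambda>m. \<Sum>w\<in>Red n \<sigma>. formal_sum (\<lambda>r. \<Prod>j<length w. X (r ! j)) (compatible w) m)"

lemma prod_X:
  assumes "finite A"
  shows "(\<Prod>z\<in>A. X (f z)) = Poly_Mapping.single (\<Sum>z\<in>A. Poly_Mapping.single (f z) 1) 1"
  using assms
proof (induction A rule: finite_induct)
  case empty
  show ?case by (simp only: prod.empty sum.empty single_one)
next
  case (insert x A)
  have "X (f x) * Poly_Mapping.single (\<Sum>z\<in>A. Poly_Mapping.single (f z) 1) 1
      = Poly_Mapping.single (Poly_Mapping.single (f x) 1 + (\<Sum>z\<in>A. Poly_Mapping.single (f z) 1)) 1"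
    by (simp only: X_def mult_single mult_1)
  then show ?case
    by (simp only: prod.insert[OF insert.hyps] sum.insert[OF insert.hyps] insert.IH)
qed

lemma lookup_prod_X_neq_0:
  assumes "finite A" "Poly_Mapping.lookup (\<Prod>z\<in>A. X (f z)) m \<noteq> 0" "z \<in> A"
  shows "f z \<in> Poly_Mapping.keys m"
proof -
  have m: "m = (\<Sum>z\<in>A. Poly_Mapping.single (f z) 1)"
    using assms(2) by (auto simp: prod_X[OF assms(1)] lookup_single when_def split: if_splits)
  have "Poly_Mapping.lookup m (f z) = (\<Sum>y\<in>A. Poly_Mapping.lookup (Poly_Mapping.single (f y) 1) (f z))"
    by (simp add: m lookup_sum)
  also have "\<dots> \<ge> Poly_Mapping.lookup (Poly_Mapping.single (f z) 1) (f z)"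
    by (rule member_le_sum[OF assms(3) _ assms(1)]) auto
  finally show ?thesis by (auto simp: in_keys_iff)
qed

lemma finite_Gamma_terms:
  assumes "finite A"
  shows "finite {f \<in> {f. semistandard D U A f}. Poly_Mapping.lookup (\<Prod>z\<in>A. X (f z)) m \<noteq> 0}"
proof (rule finite_subset)
  show "{f \<in> {f. semistandard D U A f}. Poly_Mapping.lookup (\<Prod>z\<in>A. X (f z)) m \<noteq> 0} \<subseteq> A \<rightarrow>\<^sub>E Poly_Mapping.keys m"
  proof
    fix f
    assume "f \<in> {f \<in> {f. semistandard D U A f}. Poly_Mapping.lookup (\<Prod>z\<in>A. X (f z)) m \<noteq> 0}"
    then have f: "f \<in> A \<rightarrow>\<^sub>E {0<..}" "Poly_Mapping.lookup (\<Prod>z\<in>A. X (f z)) m \<noteq> 0"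
      by (simp_all add: semistandard_def)
    show "f \<in> A \<rightarrow>\<^sub>E Poly_Mapping.keys m"
    proof (rule PiE_I)
      show "f z \<in> Poly_Mapping.keys m" if "z \<in> A" for z
        using lookup_prod_X_neq_0[OF assms f(2) that] .
      show "f z = undefined" if "z \<notin> A" for z
        using PiE_arb[OF f(1) that] .
    qed
  qed
  show "finite (A \<rightarrow>\<^sub>E Poly_Mapping.keys m)" using assms by (simp add: finite_PiE)
qed

lemma finite_compatible_terms:
  "finite {r \<in> compatible w. Poly_Mapping.lookup (\<Prod>j<length w. X (r ! j)) m \<noteq> 0}"
proof (rule finite_subset)
  show "{r \<in> compatible w. Poly_Mapping.lookup (\<Prod>j<length w. X (r ! j)) m \<noteq> 0}
          \<subseteq> {r. set r \<subseteq> Poly_Mapping.keys m \<and> length r = length w}"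
  proof safe
    fix r y
    assume r: "r \<in> compatible w" "Poly_Mapping.lookup (\<Prod>j<length w. X (r ! j)) m \<noteq> 0" and y: "y \<in> set r"
    then obtain j where "j < length w" "y = r ! j"
      by (auto simp: in_set_conv_nth compatible_def)
    then show "y \<in> Poly_Mapping.keys m"
      using lookup_prod_X_neq_0[of "{..<length w}" "\<lambda>j. r ! j" m j] r(2) by auto
  qed (simp add: compatible_def)
  show "finite {r. set r \<subseteq> Poly_Mapping.keys m \<and> length r = length w}"
    by (rule finite_lists_length_eq) simp
qed

lemma finite_Red: "finite (Red n \<sigma>)"
proof (rule finite_subset)
  show "Red n \<sigma> \<subseteq> {w. set w \<subseteq> {1..<n} \<and> length w = len n \<sigma>}"
    by (auto simp: Red_def words_of_def)
  show "finite {w. set w \<subseteq> {1..<n} \<and> length w = len n \<sigma>}"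
    by (rule finite_lists_length_eq) simp
qed

lemma finite_Inv: "finite (Inv n \<sigma>)"
  by (rule finite_subset[of _ "{1..n} \<times> {1..n}"]) (auto simp: Inv_def)

end

theory Submission
  imports Defs
begin

text \<open>A word \<open>w\<close> read from the left successively exchanges the values in adjacent positions; let the
  steps of \<open>w\<close> be the pairs of values exchanged. Throughout the peeling process, the value of a
  remaining vertex \<open>(a, b)\<close> is the number of \<open>k\<close> that lie between \<open>a\<close> and \<open>b\<close> both in value and in
  position, and \<open>(a, b)\<close> is erasable iff \<open>a\<close> stands immediately to the left of \<open>b\<close>. Hence the initial
  peeling segments with underlying set \<open>Inv n \<sigma>\<close> are the step sequences of the reduced words of \<open>\<sigma>\<close>.

  A reduced word with a compatible sequence \<open>r\<close> gives the function that takes the value \<open>r ! j\<close> on the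
  \<open>j\<close>-th step, and this is a bijection onto the semistandard functions. Given a semistandard \<open>f\<close>,
  two consecutive letters \<open>i < k\<close> whose steps have equal \<open>f\<close>-value cannot satisfy \<open>k = i + 1\<close> (the
  steps would share their first coordinate), so they commute and can be exchanged; after finitely
  many exchanges \<open>f\<close> is compatible with the word. Conversely, if \<open>u\<close> is the permutation before a
  block of constant \<open>f\<close>-value, then a letter \<open>i\<close> of the (strictly decreasing) block has a step with
  first coordinate \<open>u i\<close>. So the first coordinates in the block are distinct and \<open>f\<close> determines the
  letters.\<close>

section \<open>Adjacent transpositions, words and their steps\<close>

abbreviation adj :: "nat \<Rightarrow> nat \<Rightarrow> nat" where
  "adj i \<equiv> Transposition.transpose i (Suc i)"

lemma adj_permutes: "i \<in> {1..<n} \<Longrightarrow> adj i permutes {1..n}"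
  by (rule permutes_swap_id) auto

text \<open>Applied to positions, this isolates the single pair of values whose relative order is
  altered by one letter.\<close>

lemma adj_less_iff:
  "p \<noteq> q \<Longrightarrow> adj i p < adj i q \<longleftrightarrow> (p < q \<and> \<not> (p = i \<and> q = Suc i)) \<or> (p = Suc i \<and> q = i)"
  by (auto simp: transpose_def)

lemma word_perm_Nil [simp]: "word_perm [] = id"
  by (simp add: word_perm_def)

lemma word_perm_Cons [simp]: "word_perm (i # w) = adj i \<circ> word_perm w"
  by (simp add: word_perm_def)

lemma word_perm_append [simp]: "word_perm (v @ w) = word_perm v \<circ> word_perm w"
  by (induction v) (simp_all add: o_assoc)

lemma word_perm_permutes: "set w \<subseteq> {1..<n} \<Longrightarrow> word_perm w permutes {1..n}"
proof (induction w)
  case (Cons i w)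
  then show ?case
    using permutes_compose[of "word_perm w" "{1..n}" "adj i"] adj_permutes[of i n] by (simp del: o_apply)
qed (simp add: permutes_id)

text \<open>Here \<open>u p\<close> is the value at position \<open>p\<close>. The rightmost factor
  of a composition acts first, so multiplying by \<open>adj i\<close> on the right exchanges the
  entries at positions \<open>i\<close> and \<open>Suc i\<close>. A pair is recorded with the left
  entry first, whether or not it ascends.\<close>

fun steps :: "(nat \<Rightarrow> nat) \<Rightarrow> nat list \<Rightarrow> (nat \<times> nat) list" where
  "steps u [] = []"
| "steps u (i # w) = (u i, u (Suc i)) # steps (u \<circ> adj i) w"

lemma length_steps [simp]: "length (steps u w) = length w"
  by (induction w arbitrary: u) simp_all

lemma steps_append: "steps u (v @ w) = steps u v @ steps (u \<circ> word_perm v) w"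
  by (induction v arbitrary: u) (simp_all add: o_assoc)

lemma steps_take: "steps u (take m w) = take m (steps u w)"
proof (induction w arbitrary: u m)
  case (Cons i w)
  then show ?case by (cases m) (simp_all del: o_apply)
qed simp

lemma steps_drop: "drop m (steps u w) = steps (u \<circ> word_perm (take m w)) (drop m w)"
proof -
  have "steps u w = steps u (take m w) @ steps (u \<circ> word_perm (take m w)) (drop m w)"
    by (metis append_take_drop_id steps_append)
  then show ?thesis
    by (metis append_take_drop_id same_append_eq steps_take)
qed

section \<open>Inversion sets along a word\<close>

lemma inv_comp_adj:
  assumes "u permutes {1..n}"
  shows "inv (u \<circ> adj i) = adj i \<circ> inv u"
  by (simp add: o_inv_distrib permutes_bij[OF assms])

text \<open>Apply \<open>adj_less_iff\<close> to the positions of \<open>a\<close> and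
  \<open>b\<close>. Its last alternative would place \<open>b\<close> at \<open>i\<close> and
  \<open>a\<close> at \<open>Suc i\<close>, hence \<open>b < a\<close> because
  \<open>u i < u (Suc i)\<close>.\<close>

lemma inv_comp_adj_less:
  assumes u: "u permutes {1..n}" and up: "u i < u (Suc i)" and ab: "a < b"
  shows "inv (u \<circ> adj i) a < inv (u \<circ> adj i) b \<longleftrightarrow>
    inv u a < inv u b \<and> (a, b) \<noteq> (u i, u (Suc i))"
proof -
  have eq: "inv u x = y \<longleftrightarrow> x = u y" for x y
    using permutes_inverses[OF u] by metis
  have "inv u a \<noteq> inv u b"
    using ab permutes_inv[OF u] by (simp add: inj_eq[OF permutes_inj])
  moreover have "\<not> (inv u a = Suc i \<and> inv u b = i)"
    using ab up unfolding eq by auto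
  ultimately show ?thesis
    unfolding inv_comp_adj[OF u] o_apply adj_less_iff[OF \<open>inv u a \<noteq> inv u b\<close>]
    by (simp only: eq prod.inject) blast
qed

lemma Inv_adj:
  assumes u: "u permutes {1..n}" and i: "i \<in> {1..<n}" and up: "u i < u (Suc i)"
  shows "Inv n (u \<circ> adj i) = insert (u i, u (Suc i)) (Inv n u)"
    and "(u i, u (Suc i)) \<notin> Inv n u"
proof -
  have mem: "u i \<in> {1..n}" "u (Suc i) \<in> {1..n}"
    using permutes_in_image[OF u] i by auto
  show "(u i, u (Suc i)) \<notin> Inv n u"
    by (simp add: Inv_def permutes_inverses[OF u])
  have "inv (u \<circ> adj i) b < inv (u \<circ> adj i) a \<longleftrightarrow>
      inv u b < inv u a \<or> (a, b) = (u i, u (Suc i))" if "a < b" for a b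
  proof -
    have "inv v a \<noteq> inv v b" if "v permutes {1..n}" for v
      using \<open>a < b\<close> permutes_inv[OF that] by (simp add: inj_eq[OF permutes_inj])
    from this[OF u] this[OF permutes_compose[OF adj_permutes[OF i] u]]
      inv_comp_adj_less[OF u up that]
    show ?thesis by (meson linorder_neqE_nat not_less_iff_gr_or_eq)
  qed
  then show "Inv n (u \<circ> adj i) = insert (u i, u (Suc i)) (Inv n u)"
    using mem up unfolding Inv_def by auto
qed

lemma comp_adj_adj: "u \<circ> adj i \<circ> adj i = u"
  by (simp add: fun_eq_iff)

lemma card_Inv_adj_le:
  assumes u: "u permutes {1..n}" and i: "i \<in> {1..<n}"
  shows "card (Inv n (u \<circ> adj i)) \<le> Suc (card (Inv n u))"
    and "u (Suc i) < u i \<Longrightarrow> Suc (card (Inv n (u \<circ> adj i))) = card (Inv n u)"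
proof -
  have pu: "u \<circ> adj i permutes {1..n}"
    by (rule permutes_compose[OF adj_permutes[OF i] u])
  have inj: "u (Suc i) \<noteq> u i"
    by (simp add: inj_eq[OF permutes_inj[OF u]])
  \<comment> \<open>A descent of \<open>u\<close> is an ascent of \<open>u \<circ> adj i\<close>, so
    this is \<open>Inv_adj\<close> read backwards.\<close>
  show down: "Suc (card (Inv n (u \<circ> adj i))) = card (Inv n u)" if "u (Suc i) < u i"
    using Inv_adj[OF pu i] that by (simp add: comp_adj_adj finite_Inv)
  show "card (Inv n (u \<circ> adj i)) \<le> Suc (card (Inv n u))"
  proof (cases "u i < u (Suc i)")
    case True
    then show ?thesis using Inv_adj[OF u i] by (simp add: finite_Inv)
  next
    case False
    then show ?thesis using down inj by simp
  qed
qed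

text \<open>By \<open>Inv_adj\<close> an ascending step adds its own pair, which was not an
  inversion before; so no pair is exchanged twice.\<close>

lemma Inv_comp_word_perm:
  assumes "u permutes {1..n}" "set w \<subseteq> {1..<n}" "\<forall>(a, b)\<in>set (steps u w). a < b"
  shows "distinct (steps u w)" and "set (steps u w) \<inter> Inv n u = {}"
    and "Inv n (u \<circ> word_perm w) = set (steps u w) \<union> Inv n u"
proof -
  have "distinct (steps u w) \<and> set (steps u w) \<inter> Inv n u = {} \<and>
      Inv n (u \<circ> word_perm w) = set (steps u w) \<union> Inv n u"
    using assms
  proof (induction w arbitrary: u)
    case (Cons i w)
    then have i: "i \<in> {1..<n}" and up: "u i < u (Suc i)" by auto
    have "u \<circ> adj i permutes {1..n}"
      by (rule permutes_compose[OF adj_permutes[OF i] Cons.prems(1)])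
    from Cons.IH[OF this] Inv_adj[OF Cons.prems(1) i up] Cons.prems show ?case
      by (auto simp: o_assoc simp del: o_apply)
  qed simp
  then show "distinct (steps u w)" "set (steps u w) \<inter> Inv n u = {}"
      "Inv n (u \<circ> word_perm w) = set (steps u w) \<union> Inv n u"
    by blast+
qed

text \<open>A letter adds one inversion at an ascent and removes one at a descent. A single descent
  leaves the count at least two short of the bound, so equality forces every step to ascend.\<close>

lemma card_Inv_comp_word_perm:
  assumes "u permutes {1..n}" "set w \<subseteq> {1..<n}"
  shows "card (Inv n (u \<circ> word_perm w)) \<le> card (Inv n u) + length w"
    and "card (Inv n (u \<circ> word_perm w)) = card (Inv n u) + length w
      \<Longrightarrow> \<forall>(a, b)\<in>set (steps u w). a < b"
proof -
  have "card (Inv n (u \<circ> word_perm w)) \<le> card (Inv n u) + length w \<and>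
    (card (Inv n (u \<circ> word_perm w)) = card (Inv n u) + length w
      \<longrightarrow> (\<forall>(a, b)\<in>set (steps u w). a < b))"
    using assms
  proof (induction w arbitrary: u)
    case (Cons i w)
    then have i: "i \<in> {1..<n}" by auto
    have "u \<circ> adj i permutes {1..n}"
      by (rule permutes_compose[OF adj_permutes[OF i] Cons.prems(1)])
    note IH = Cons.IH[OF this]
    have "u (Suc i) \<noteq> u i"
      by (simp add: inj_eq[OF permutes_inj[OF Cons.prems(1)]])
    with IH card_Inv_adj_le[OF Cons.prems(1) i] Cons.prems show ?case
      by (cases "u (Suc i) < u i") (auto simp: o_assoc simp del: o_apply)
  qed simp
  then show "card (Inv n (u \<circ> word_perm w)) \<le> card (Inv n u) + length w"
    "card (Inv n (u \<circ> word_perm w)) = card (Inv n u) + length w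
      \<Longrightarrow> \<forall>(a, b)\<in>set (steps u w). a < b"
    by blast+
qed

section \<open>Length and reduced words\<close>

lemma Inv_id [simp]: "Inv n id = {}"
  by (auto simp: Inv_def)

text \<open>The position of a value is one more than the number of values to its left, and the
  inversions tell which of two values stands to the left. So all positions can be recovered.\<close>

lemma Inv_inject:
  assumes u: "u permutes {1..n}" and v: "v permutes {1..n}" and eq: "Inv n u = Inv n v"
  shows "u = v"
proof -
  have pos: "card {b \<in> {1..n}. inv w b < inv w a} = inv w a - 1"
    if w: "w permutes {1..n}" and a: "a \<in> {1..n}" for w a
  proof -
    have "inv w a \<in> {1..n}"
      using permutes_in_image[OF permutes_inv[OF w]] a by blast
    moreover have "{b \<in> {1..n}. inv w b < inv w a} = w ` {1..<inv w a}"
    proof (intro set_eqI iffI)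
      fix b assume "b \<in> {b \<in> {1..n}. inv w b < inv w a}"
      moreover from this have "inv w b \<in> {1..n}"
        using permutes_in_image[OF permutes_inv[OF w]] by blast
      ultimately show "b \<in> w ` {1..<inv w a}"
        using permutes_inverses(1)[OF w, of b] by (intro image_eqI[of _ _ "inv w b"]) auto
    next
      fix b assume "b \<in> w ` {1..<inv w a}"
      then obtain p where "b = w p" "p \<in> {1..<inv w a}" by blast
      with \<open>inv w a \<in> {1..n}\<close> show "b \<in> {b \<in> {1..n}. inv w b < inv w a}"
        using permutes_in_image[OF w, of p] permutes_inverses(2)[OF w, of p] by auto
    qed
    ultimately show ?thesis
      using card_image[OF permutes_inj_on[OF w], of "{1..<inv w a}"] by simp
  qed
  have less: "inv u b < inv u a \<longleftrightarrow> inv v b < inv v a" if "a \<in> {1..n}" "b \<in> {1..n}" for a b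
  proof -
    have inj: "inv u b \<noteq> inv u a" "inv v b \<noteq> inv v a" if "a \<noteq> b"
      using that permutes_inverses(1)[OF u] permutes_inverses(1)[OF v] by metis+
    have "(a, b) \<in> Inv n u \<longleftrightarrow> (a, b) \<in> Inv n v" "(b, a) \<in> Inv n u \<longleftrightarrow> (b, a) \<in> Inv n v"
      using eq by auto
    with that inj show ?thesis
      by (cases a b rule: linorder_cases) (auto simp: Inv_def not_less)
  qed
  have "inv u a = inv v a" for a
  proof (cases "a \<in> {1..n}")
    case True
    have "{b \<in> {1..n}. inv u b < inv u a} = {b \<in> {1..n}. inv v b < inv v a}"
      using less[OF True] by blast
    then have "inv u a - 1 = inv v a - 1"
      using pos[OF u True] pos[OF v True] by simp
    moreover have "inv u a \<in> {1..n}" "inv v a \<in> {1..n}"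
      using permutes_in_image[OF permutes_inv[OF u]] permutes_in_image[OF permutes_inv[OF v]] True
      by blast+
    ultimately show ?thesis by auto
  next
    case False
    then show ?thesis
      using permutes_not_in[OF permutes_inv[OF u]] permutes_not_in[OF permutes_inv[OF v]] by metis
  qed
  then show ?thesis
    by (metis ext inv_inv_eq permutes_bij u v)
qed

lemma ex_descent:
  assumes u: "u permutes {1..n}" and "Inv n u \<noteq> {}"
  obtains i where "i \<in> {1..<n}" "u (Suc i) < u i"
proof (rule ccontr)
  assume "\<not> thesis"
  then have up: "u i \<le> u (Suc i)" if "i \<in> {1..<n}" for i
    using that \<open>\<And>i. i \<in> {1..<n} \<Longrightarrow> u (Suc i) < u i \<Longrightarrow> thesis\<close> by (meson not_le)
  have mono: "u p \<le> u q" if "p \<le> q" "1 \<le> p" "q \<le> n" for p q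
    using that
  proof (induction q rule: dec_induct)
    case (step q)
    then show ?case using up[of q] by auto
  qed simp
  obtain a b where ab: "(a, b) \<in> Inv n u" using assms(2) by auto
  then have "inv u a \<in> {1..n}" "inv u b \<in> {1..n}"
    using permutes_in_image[OF permutes_inv[OF u]] by (auto simp: Inv_def)
  with ab mono[of "inv u b" "inv u a"] show False
    by (auto simp: Inv_def permutes_inverses[OF u])
qed

text \<open>Sorting by adjacent exchanges: undoing a descent removes one inversion, and its letter
  is appended to a word of the permutation thus obtained.\<close>

lemma ex_word_card_Inv:
  "\<sigma> permutes {1..n} \<Longrightarrow> \<exists>w\<in>words_of n \<sigma>. length w = card (Inv n \<sigma>)"
proof (induction "card (Inv n \<sigma>)" arbitrary: \<sigma>)
  case 0
  then have "\<sigma> = id"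
    using Inv_inject[of \<sigma> n id] by (simp add: finite_Inv permutes_id)
  then have "[] \<in> words_of n \<sigma>" by (simp add: words_of_def)
  with "0.hyps" show ?case by (intro bexI[of _ "[]"]) simp_all
next
  case (Suc k)
  then obtain i where i: "i \<in> {1..<n}" "\<sigma> (Suc i) < \<sigma> i"
    using ex_descent by (metis card.empty nat.distinct(1))
  have "\<sigma> \<circ> adj i permutes {1..n}"
    by (rule permutes_compose[OF adj_permutes[OF i(1)] Suc.prems])
  with Suc.hyps card_Inv_adj_le(2)[OF Suc.prems i]
  obtain w where "w \<in> words_of n (\<sigma> \<circ> adj i)" "length w = k"
    by (metis nat.inject)
  then have "w @ [i] \<in> words_of n \<sigma>" "length (w @ [i]) = Suc k"
    using i by (auto simp: words_of_def comp_adj_adj)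
  with Suc.hyps(2) show ?case by metis
qed

lemma len_eq_card_Inv:
  assumes "\<sigma> permutes {1..n}"
  shows "len n \<sigma> = card (Inv n \<sigma>)"
  unfolding len_def
proof (rule Least_equality)
  fix l assume "\<exists>w\<in>words_of n \<sigma>. length w = l"
  then show "card (Inv n \<sigma>) \<le> l"
    using card_Inv_comp_word_perm(1)[OF permutes_id] by (auto simp: words_of_def)
qed (rule ex_word_card_Inv[OF assms])

text \<open>Replaces the minimality of the length by a condition on single steps, the form in which
  erasability appears. The length is the number of inversions, and it is attained exactly when each
  letter adds one.\<close>

lemma Red_iff:
  assumes "\<sigma> permutes {1..n}"
  shows "w \<in> Red n \<sigma> \<longleftrightarrow> set w \<subseteq> {1..<n} \<and> word_perm w = \<sigma> \<and>
    (\<forall>(a, b)\<in>set (steps id w). a < b)"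
proof -
  have "length w = card (Inv n (word_perm w)) \<longleftrightarrow> (\<forall>(a, b)\<in>set (steps id w). a < b)"
    if w: "set w \<subseteq> {1..<n}"
    using card_Inv_comp_word_perm(2)[OF permutes_id w]
      Inv_comp_word_perm[OF permutes_id w] distinct_card[of "steps id w"] by auto
  then show ?thesis
    unfolding Red_def words_of_def len_eq_card_Inv[OF assms] by auto
qed

lemma Red_steps:
  assumes "\<sigma> permutes {1..n}" "w \<in> Red n \<sigma>"
  shows "distinct (steps id w)" "set (steps id w) = Inv n \<sigma>"
  using assms(2) Inv_comp_word_perm[OF permutes_id, of w n] unfolding Red_iff[OF assms(1)] by auto

section \<open>The digraph left after peeling\<close>

text \<open>The invariant of the process, with \<open>u\<close> the permutation reached so far. Only
  remaining vertices have a prescribed value, since \<open>theta\<close> is total and keeps leftover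
  values at deleted vertices.\<close>

definition residual :: "nat \<Rightarrow> (nat \<Rightarrow> nat) \<Rightarrow> (nat \<times> nat) valued_digraph \<Rightarrow> bool" where
  "residual n u D \<longleftrightarrow> pverts D = lam n - Inv n u \<and>
     parcs D = {(y, z) \<in> parcs (digraph_A n). y \<notin> Inv n u \<and> z \<notin> Inv n u} \<and>
     (\<forall>a b. (a, b) \<in> lam n - Inv n u \<longrightarrow>
       theta D (a, b) = int (card {k. a < k \<and> k < b \<and> inv u a < inv u k \<and> inv u k < inv u b}))"

lemma residual_id: "residual n id (digraph_A n)"
proof -
  have "{k. a < k \<and> k < b \<and> a < k \<and> k < b} = {a<..<b}" for a b :: nat
    by auto
  then show ?thesis
    unfolding residual_def Inv_id
    by (auto simp: digraph_A_def lam_def)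
qed

text \<open>Only the erased pair changes its relative order, so the entries counted for
  \<open>(a, b)\<close> lose \<open>k\<close> exactly when \<open>(a, k)\<close> or
  \<open>(k, b)\<close> is that pair. This is also when \<open>(a, b)\<close> has an arc to it, so
  \<open>erase\<close> decreases the right values.\<close>

lemma residual_erase:
  assumes u: "u permutes {1..n}" and i: "i \<in> {1..<n}" and up: "u i < u (Suc i)"
    and D: "residual n u D"
  shows "residual n (u \<circ> adj i) (erase D (u i, u (Suc i)))"
proof -
  let ?z = "(u i, u (Suc i))"
  let ?B = "\<lambda>u a b. {k. a < k \<and> k < b \<and> inv u a < inv u k \<and> inv u k < inv u b}"
  note Inv = Inv_adj[OF u i up]
  have eq: "inv u x = y \<longleftrightarrow> x = u y" for x y
    using permutes_inverses[OF u] by metis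
  have mem: "u i \<in> {1..n}" "u (Suc i) \<in> {1..n}"
    using permutes_in_image[OF u] i by auto
  note less = inv_comp_adj_less[OF u up]
  have arcs: "(y, z) \<in> parcs D \<longleftrightarrow>
      (y, z) \<in> parcs (digraph_A n) \<and> y \<notin> Inv n u \<and> z \<notin> Inv n u" for y z
    using D by (simp add: residual_def)
  have "theta (erase D ?z) (a, b) = int (card (?B (u \<circ> adj i) a b))"
    if ab: "(a, b) \<in> lam n" "(a, b) \<notin> Inv n u" "(a, b) \<noteq> ?z" for a b
  proof -
    have fin: "finite (?B u a b)" by (rule finite_subset[of _ "{..b}"]) auto
    have th: "theta D (a, b) = int (card (?B u a b))"
      using D ab by (simp add: residual_def)
    have B: "?B (u \<circ> adj i) a b = {k \<in> ?B u a b. (a, k) \<noteq> ?z \<and> (k, b) \<noteq> ?z}"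
      using less[of a] less[of _ b] by blast
    have pos: "inv u a < inv u b"
    proof -
      have "a < b" "a \<in> {1..n}" "b \<in> {1..n}" using ab by (auto simp: lam_def)
      moreover have "inv u a \<noteq> inv u b" using \<open>a < b\<close> eq by (metis less_irrefl)
      ultimately show ?thesis using ab(2) by (auto simp: Inv_def)
    qed
    show ?thesis
    proof (cases "((a, b), ?z) \<in> parcs D")
      case True
      then obtain k where k: "a < k" "k < b" "?z = (a, k) \<or> ?z = (k, b)"
        by (auto simp: arcs digraph_A_def)
      \<comment> \<open>The arc only places \<open>k\<close> between \<open>a\<close> and
        \<open>b\<close> in value. For the positions: \<open>k\<close> is adjacent to one of the
        two, and the other one, being distinct from \<open>k\<close>, lies beyond it.\<close>
      have "k \<in> ?B u a b"
      proof (cases "?z = (a, k)")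
        case True
        then have "inv u a = i" "inv u k = Suc i" using eq by auto
        moreover have "inv u b \<noteq> Suc i" using k(2) True eq by auto
        ultimately show ?thesis using k pos by auto
      next
        case False
        then have "inv u k = i" "inv u b = Suc i" using k eq by auto
        moreover have "inv u a \<noteq> i" using k False eq by auto
        ultimately show ?thesis using k pos by auto
      qed
      moreover have "?B (u \<circ> adj i) a b = ?B u a b - {k}"
        unfolding B using k by auto
      ultimately have "Suc (card (?B (u \<circ> adj i) a b)) = card (?B u a b)"
        using fin by (simp only: card.remove[OF fin])
      then show ?thesis using True th by (simp add: erase_def)
    next
      case False
      have "(a, k) \<noteq> ?z \<and> (k, b) \<noteq> ?z" if "a < k" "k < b" for k
      proof (rule ccontr)
        assume "\<not> ?thesis"
        then have "((a, b), ?z) \<in> parcs (digraph_A n)"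
          using that ab mem up by (auto simp: digraph_A_def lam_def)
        with False Inv(2) ab show False by (simp add: arcs)
      qed
      then have "?B (u \<circ> adj i) a b = ?B u a b"
        unfolding B by blast
      then show ?thesis using False th by (simp add: erase_def)
    qed
  qed
  then show ?thesis
    using D unfolding residual_def Inv(1) by (auto simp: erase_def)
qed

text \<open>If (\<open>a\<close>, \<open>b\<close>) has value 0 but some entry still stands between
  the two, its value is above \<open>b\<close> or below \<open>a\<close>. The nearest such entry in
  value then gives a second vertex of value 0 with an arc into (\<open>a\<close>, \<open>b\<close>),
  which blocks the erasure. So \<open>a\<close> and \<open>b\<close> are adjacent.\<close>

lemma residual_erasable_iff:
  assumes u: "u permutes {1..n}" and D: "residual n u D"
  shows "erasable D z \<longleftrightarrow> (\<exists>i\<in>{1..<n}. u i < u (Suc i) \<and> z = (u i, u (Suc i)))"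
proof -
  have eq: "inv u x = y \<longleftrightarrow> x = u y" for x y
    using permutes_inverses[OF u] by metis
  have range: "inv u a \<in> {1..n} \<longleftrightarrow> a \<in> {1..n}" for a
    using permutes_in_image[OF permutes_inv[OF u]] by blast
  have vert: "(a, b) \<in> pverts D \<longleftrightarrow> a < b \<and> inv u a < inv u b \<and> a \<in> {1..n} \<and> b \<in> {1..n}" for a b
  proof -
    have "inv u a \<noteq> inv u b" if "a < b" using that eq by (metis less_irrefl)
    then show ?thesis using D by (auto simp: residual_def lam_def Inv_def not_less)
  qed
  have zero: "theta D (a, b) = 0 \<longleftrightarrow>
      (\<forall>k. a < k \<and> k < b \<longrightarrow> \<not> (inv u a < inv u k \<and> inv u k < inv u b))"
    if "(a, b) \<in> pverts D" for a b
  proof -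
    have "finite {k. a < k \<and> k < b \<and> inv u a < inv u k \<and> inv u k < inv u b}"
      by (rule finite_subset[of _ "{..b}"]) auto
    then show ?thesis using D that by (auto simp: residual_def)
  qed
  have arc: "((a, b), (c, d)) \<in> parcs D \<longleftrightarrow> (a, b) \<in> pverts D \<and> (c, d) \<in> pverts D \<and>
      (a = c \<and> d < b \<or> b = d \<and> a < c)" for a b c d
    using D by (auto simp: residual_def digraph_A_def lam_def)
  obtain a b where z: "z = (a, b)" by force
  show ?thesis
  proof
    assume er: "erasable D z"
    then have ab: "(a, b) \<in> pverts D" "theta D (a, b) = 0"
      by (simp_all add: erasable_def z)
    note between = zero[OF ab(1), THEN iffD1, OF ab(2), rule_format]
    have blocked: "theta D (c, d) \<noteq> 0"
      if "(c, d) \<in> pverts D" "c = a \<and> b < d \<or> d = b \<and> c < a" for c d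
      using er that arc ab(1) by (fastforce simp: erasable_def z)
    have gap: "\<not> (inv u a < inv u d \<and> inv u d < inv u b)" for d
    proof
      assume d: "inv u a < inv u d \<and> inv u d < inv u b"
      have "inv u d \<in> {1..n}"
        using d range[of a] range[of b] ab(1) by (simp add: vert)
      then have dn: "d \<in> {1..n}" using range by blast
      have "d \<noteq> a" "d \<noteq> b" using d by auto
      with between[of d] d consider "b < d" | "d < a" by force
      then show False
      proof cases
        case 1
        \<comment> \<open>An entry \<open>k\<close> counted for \<open>(a, e)\<close> would
          contradict \<open>between\<close> if \<open>k < b\<close>, the order of the positions if
          \<open>k = b\<close>, and the choice of \<open>e\<close> if \<open>b < k\<close>.\<close>
        define e where "e = (LEAST d. b < d \<and> inv u a < inv u d \<and> inv u d < inv u b)"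
        have e: "b < e \<and> inv u a < inv u e \<and> inv u e < inv u b"
          unfolding e_def by (rule LeastI[of _ d]) (use 1 d in auto)
        have "e \<le> d" unfolding e_def by (rule Least_le) (use 1 d in auto)
        then have ae: "(a, e) \<in> pverts D"
          using e dn ab(1) by (auto simp: vert)
        moreover have "theta D (a, e) = 0"
          unfolding zero[OF ae]
        proof (intro allI impI notI)
          fix k assume k: "a < k \<and> k < e" "inv u a < inv u k \<and> inv u k < inv u e"
          show False
          proof (cases k b rule: linorder_cases)
            case less
            then show ?thesis using between[of k] k e by auto
          next
            case equal
            then show ?thesis using k e by auto
          next
            case greater
            then have "e \<le> k" unfolding e_def by (intro Least_le) (use k e in auto)
            then show ?thesis using k by simp
          qed
        qed
        ultimately show False using blocked e by blast
      next
        case 2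
        \<comment> \<open>Mirror image: the largest suitable value below \<open>a\<close> makes
          \<open>(c, b)\<close> the blocking vertex.\<close>
        define S where "S = {c. c < a \<and> inv u a < inv u c \<and> inv u c < inv u b}"
        define c where "c = Max S"
        have S: "finite S" "d \<in> S"
          using 2 d by (auto simp: S_def)
        then have cS: "c \<in> S" "d \<le> c" unfolding c_def by (auto intro: Max_in)
        then have cb: "(c, b) \<in> pverts D"
          using dn ab(1) by (auto simp: vert S_def)
        moreover have "theta D (c, b) = 0"
          unfolding zero[OF cb]
        proof (intro allI impI notI)
          fix k assume k: "c < k \<and> k < b" "inv u c < inv u k \<and> inv u k < inv u b"
          show False
          proof (cases k a rule: linorder_cases)
            case greater
            then show ?thesis using between[of k] k cS by (auto simp: S_def)
          next
            case equal
            then show ?thesis using k cS by (auto simp: S_def)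
          next
            case less
            then have "k \<in> S" using k cS by (auto simp: S_def)
            then have "k \<le> c" unfolding c_def using S by simp
            then show ?thesis using k by simp
          qed
        qed
        ultimately show False using blocked cS by (auto simp: S_def)
      qed
    qed
    define i where "i = inv u a"
    have i: "i < inv u b" "1 \<le> i" "inv u b \<le> n" "a < b"
      using ab(1) range[of a] range[of b] by (auto simp: vert i_def)
    have "inv u b = Suc i"
    proof (rule ccontr)
      assume "inv u b \<noteq> Suc i"
      with i have "i < Suc i \<and> Suc i < inv u b" by simp
      with gap[of "u (Suc i)"] show False
        by (simp add: i_def permutes_inverses[OF u])
    qed
    then have "a = u i" "b = u (Suc i)" using eq i_def by metis+
    with i \<open>inv u b = Suc i\<close> show "\<exists>i\<in>{1..<n}. u i < u (Suc i) \<and> z = (u i, u (Suc i))"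
      by (intro bexI[of _ i]) (auto simp: z)
  next
    assume "\<exists>i\<in>{1..<n}. u i < u (Suc i) \<and> z = (u i, u (Suc i))"
    then obtain i where i: "i \<in> {1..<n}" "u i < u (Suc i)" "a = u i" "b = u (Suc i)"
      by (auto simp: z)
    then have pos: "inv u a = i" "inv u b = Suc i" using eq by auto
    then have ab: "(a, b) \<in> pverts D"
      using i range[of a] range[of b] by (auto simp: vert)
    \<comment> \<open>The source \<open>(c, d)\<close> shares one end with \<open>(a, b)\<close> and
      counts the other end of \<open>(a, b)\<close> as an entry in between.\<close>
    have "theta D (c, d) \<noteq> 0" if "((c, d), (a, b)) \<in> parcs D" for c d
    proof -
      have cd: "(c, d) \<in> pverts D" "c = a \<and> b < d \<or> d = b \<and> c < a"
        using that by (auto simp: arc)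
      from cd(2) show ?thesis
      proof
        assume "c = a \<and> b < d"
        moreover from this have "inv u d \<noteq> Suc i" using eq i(4) by auto
        ultimately show ?thesis
          unfolding zero[OF cd(1)] using cd(1) pos ab by (auto simp: vert intro!: exI[of _ b])
      next
        assume "d = b \<and> c < a"
        moreover from this have "inv u c \<noteq> i" using eq i(3) by auto
        ultimately show ?thesis
          unfolding zero[OF cd(1)] using cd(1) pos ab by (auto simp: vert intro!: exI[of _ a])
      qed
    qed
    then show "erasable D z"
      using ab pos by (auto simp: erasable_def z zero[OF ab])
  qed
qed

section \<open>Initial segments of peeling sequences\<close>

text \<open>\<open>PS\<close> speaks of initial segments of complete runs. A partial run on a finite
  digraph always extends to a complete one, so this condition without maximality suffices and is
  open to induction on the list.\<close>

fun peelable :: "'a valued_digraph \<Rightarrow> 'a list \<Rightarrow> bool" where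
  "peelable D [] \<longleftrightarrow> True"
| "peelable D (x # xs) \<longleftrightarrow> erasable D x \<and> peelable (erase D x) xs"

lemma ex_peeling_sequence:
  "finite (pverts D) \<Longrightarrow> \<exists>L. peeling_sequence D L"
proof (induction "card (pverts D)" arbitrary: D rule: less_induct)
  case less
  show ?case
  proof (cases "\<exists>x. erasable D x")
    case True
    then obtain x where x: "erasable D x" by blast
    have "card (pverts (erase D x)) < card (pverts D)"
      using card_Diff1_less[OF less.prems, of x] x by (simp add: erasable_def erase_def)
    then obtain L where "peeling_sequence (erase D x) L"
      using less.hyps[of "erase D x"] less.prems by (auto simp: erase_def)
    with x have "peeling_sequence D (x # L)" by simp
    then show ?thesis by blast
  next
    case False
    then have "peeling_sequence D []" by simp
    then show ?thesis by blast
  qed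
qed

lemma peelable_iff:
  "finite (pverts D) \<Longrightarrow> peelable D zs \<longleftrightarrow> (\<exists>L. peeling_sequence D (zs @ L))"
proof (induction zs arbitrary: D)
  case Nil
  then show ?case using ex_peeling_sequence by simp
next
  case (Cons z zs)
  then have "finite (pverts (erase D z))" by (simp add: erase_def)
  with Cons.IH show ?case by simp
qed

lemma PS_iff:
  assumes "finite (pverts D)"
  shows "zs \<in> PS D A \<longleftrightarrow> distinct zs \<and> set zs = A \<and> peelable D zs"
proof -
  have "(\<exists>L. peeling_sequence D L \<and> length zs \<le> length L \<and> zs = take (length zs) L) \<longleftrightarrow>
      (\<exists>L. peeling_sequence D (zs @ L))"
    by (metis append_eq_conv_conj append_take_drop_id length_append le_add1)
  then show ?thesis
    unfolding PS_def peelable_iff[OF assms] by (auto simp: distinct_card)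
qed

lemma residual_peelable_iff:
  assumes "u permutes {1..n}" "residual n u D"
  shows "peelable D zs \<longleftrightarrow>
    (\<exists>w. set w \<subseteq> {1..<n} \<and> zs = steps u w \<and> (\<forall>(a, b)\<in>set zs. a < b))"
  using assms
proof (induction zs arbitrary: u D)
  case Nil
  show ?case by (auto intro: exI[of _ "[]"])
next
  case (Cons z zs)
  have IH: "peelable (erase D z) zs \<longleftrightarrow>
      (\<exists>w. set w \<subseteq> {1..<n} \<and> zs = steps (u \<circ> adj i) w \<and> (\<forall>(a, b)\<in>set zs. a < b))"
    if "i \<in> {1..<n}" "u i < u (Suc i)" "z = (u i, u (Suc i))" for i
    using Cons.IH[OF permutes_compose[OF adj_permutes[OF that(1)] Cons.prems(1)]
      residual_erase[OF Cons.prems(1) that(1,2) Cons.prems(2)]] that(3) by blast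
  show ?case (is "_ \<longleftrightarrow> ?R")
  proof
    assume "peelable D (z # zs)"
    then obtain i where i: "i \<in> {1..<n}" "u i < u (Suc i)" "z = (u i, u (Suc i))"
      and "peelable (erase D z) zs"
      using residual_erasable_iff[OF Cons.prems] by auto
    then obtain w where "set w \<subseteq> {1..<n}" "zs = steps (u \<circ> adj i) w" "\<forall>(a, b)\<in>set zs. a < b"
      using IH by blast
    with i show ?R by (intro exI[of _ "i # w"]) simp
  next
    assume ?R
    then obtain w' where w': "set w' \<subseteq> {1..<n}" "z # zs = steps u w'" "\<forall>(a, b)\<in>set (z # zs). a < b"
      by blast
    then obtain i w where "w' = i # w" by (cases w') auto
    with w' have i: "i \<in> {1..<n}" "u i < u (Suc i)" "z = (u i, u (Suc i))"
      and "set w \<subseteq> {1..<n}" "zs = steps (u \<circ> adj i) w" "\<forall>(a, b)\<in>set zs. a < b"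
      by auto
    with IH[OF i] show "peelable D (z # zs)"
      using residual_erasable_iff[OF Cons.prems] by auto
  qed
qed

lemma PS_digraph_A:
  assumes \<sigma>: "\<sigma> permutes {1..n}"
  shows "PS (digraph_A n) (Inv n \<sigma>) = steps id ` Red n \<sigma>"
proof (intro set_eqI iffI)
  have fin: "finite (pverts (digraph_A n))"
    by (rule finite_subset[of _ "{1..n} \<times> {1..n}"]) (auto simp: digraph_A_def lam_def)
  note PS_iff' = PS_iff[OF fin] residual_peelable_iff[OF permutes_id residual_id]
  fix zs
  show "zs \<in> steps id ` Red n \<sigma>" if "zs \<in> PS (digraph_A n) (Inv n \<sigma>)"
  proof -
    from that obtain w where w: "set w \<subseteq> {1..<n}" "zs = steps id w" "\<forall>(a, b)\<in>set zs. a < b"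
      and "set zs = Inv n \<sigma>"
      unfolding PS_iff' by blast
    \<comment> \<open>The erased set is the inversion set of \<open>word_perm w\<close>. As
      inversion sets determine permutations, prescribing this set singles out \<sigma>.\<close>
    then have "Inv n (word_perm w) = Inv n \<sigma>"
      using Inv_comp_word_perm(3)[OF permutes_id, of w n] by simp
    then have "word_perm w = \<sigma>"
      using Inv_inject[OF word_perm_permutes \<sigma>] w(1) by blast
    with w show ?thesis using Red_iff[OF \<sigma>] by blast
  qed
  show "zs \<in> PS (digraph_A n) (Inv n \<sigma>)" if "zs \<in> steps id ` Red n \<sigma>"
    using that Red_steps[OF \<sigma>] Red_iff[OF \<sigma>] unfolding PS_iff' by blast
qed

section \<open>Functions strict at ascents, and uniqueness of the word\<close>

text \<open>Unlike \<open>compatible\<close>, this asks for strictness at equal consecutive letters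
  too. Blocks of constant \<open>f\<close>-value are then strictly decreasing even if the word is
  not known to be reduced, which allows an arbitrary start \<open>u\<close>.\<close>

definition strict_at_ascents :: "((nat \<times> nat) \<Rightarrow> nat) \<Rightarrow> (nat \<Rightarrow> nat) \<Rightarrow> nat list \<Rightarrow> bool" where
  "strict_at_ascents f u w \<longleftrightarrow> sorted (map f (steps u w)) \<and>
     (\<forall>j. Suc j < length w \<longrightarrow>
       w ! Suc j < w ! j \<or> f (steps u w ! j) < f (steps u w ! Suc j))"

lemma strict_at_ascents_Cons:
  assumes "strict_at_ascents f u (i # w)"
  shows "strict_at_ascents f (u \<circ> adj i) w"
proof -
  have *: "w ! Suc j < w ! j \<or> f (steps (u \<circ> adj i) w ! j) < f (steps (u \<circ> adj i) w ! Suc j)"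
    if "Suc j < length w" for j
  proof -
    have "Suc (Suc j) < length (i # w)" using that by simp
    with assms have "(i # w) ! Suc (Suc j) < (i # w) ! Suc j \<or>
        f (steps u (i # w) ! Suc j) < f (steps u (i # w) ! Suc (Suc j))"
      unfolding strict_at_ascents_def by blast
    then show ?thesis by (simp del: o_apply)
  qed
  moreover have "sorted (map f (steps (u \<circ> adj i) w))"
    using assms by (simp add: strict_at_ascents_def del: o_apply)
  ultimately show ?thesis
    unfolding strict_at_ascents_def by blast
qed

lemma strict_at_ascents_drop:
  "strict_at_ascents f u w \<Longrightarrow> strict_at_ascents f (u \<circ> word_perm (take p w)) (drop p w)"
proof (induction p arbitrary: u w)
  case (Suc p)
  then show ?case
  proof (cases w)
    case (Cons i v)
    from Suc.IH[OF strict_at_ascents_Cons[OF Suc.prems[unfolded Cons]]]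
    show ?thesis unfolding Cons by (simp add: o_assoc del: o_apply)
  qed simp
qed simp

text \<open>In a strictly decreasing word, the entry moved up by a letter has not been moved by the
  preceding letters.\<close>

lemma fst_steps_decreasing:
  "sorted_wrt (>) w \<Longrightarrow> map fst (steps u w) = map u w"
proof (induction w arbitrary: u)
  case (Cons i w)
  then have "map (u \<circ> adj i) w = map u w"
    by (auto simp: transpose_def)
  moreover have "map fst (steps (u \<circ> adj i) w) = map (u \<circ> adj i) w"
    using Cons by (simp del: o_apply)
  ultimately show ?case by (simp del: o_apply)
qed simp

text \<open>By monotonicity \<open>f\<close> is constant on the first \<open>Suc q\<close> steps.
  Their letters therefore decrease strictly, and \<open>fst_steps_decreasing\<close> applies to
  them.\<close>

lemma fst_steps_level:
  assumes good: "strict_at_ascents f u w" and q: "q < length w"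
    and eq: "f (steps u w ! q) = f (steps u w ! 0)"
  shows "fst (steps u w ! q) = u (w ! q)" and "0 < q \<Longrightarrow> w ! q < w ! 0"
proof -
  let ?r = "map f (steps u w)" and ?v = "take (Suc q) w"
  have const: "?r ! j = ?r ! 0" if "j \<le> q" for j
  proof -
    have "sorted ?r" using good by (simp add: strict_at_ascents_def)
    then have "?r ! 0 \<le> ?r ! j" "?r ! j \<le> ?r ! q"
      using that q by (auto intro!: sorted_nth_mono simp del: nth_map)
    moreover have "?r ! q = ?r ! 0" using eq q by (cases w) (auto simp del: steps.simps)
    ultimately show ?thesis by simp
  qed
  have dec: "sorted_wrt (>) ?v"
    unfolding sorted_wrt_iff_nth_Suc_transp[OF transp_on_greater]
  proof (intro allI impI)
    fix j assume "Suc j < length ?v"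
    then have j: "Suc j < length w" "Suc j \<le> q" by auto
    with const[of j] const[of "Suc j"] have "f (steps u w ! j) = f (steps u w ! Suc j)" by simp
    with good j(1) have "w ! Suc j < w ! j" by (auto simp: strict_at_ascents_def)
    with j show "?v ! j > ?v ! Suc j" by simp
  qed
  have "map fst (steps u ?v) ! q = map u ?v ! q"
    using fst_steps_decreasing[OF dec] by simp
  then show "fst (steps u w ! q) = u (w ! q)"
    using q by (simp add: steps_take)
  show "w ! q < w ! 0" if "0 < q"
    using sorted_wrt_nth_less[OF dec that] q by simp
qed

text \<open>The steps of minimal \<open>f\<close>-value form the initial block of either word. There
  the first coordinate of a step gives back its letter, and the first letter is the largest. So the
  first letters agree, and induction does the rest.\<close>

lemma strict_at_ascents_unique:
  assumes "inj u" "strict_at_ascents f u w" "strict_at_ascents f u w'"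
    "distinct (steps u w)" "distinct (steps u w')" "set (steps u w) = set (steps u w')"
  shows "w = w'"
  using assms
proof (induction w arbitrary: u w')
  case Nil
  then have "steps u w' = []" by simp
  then show ?case by (metis length_0_conv length_steps)
next
  case (Cons i w u v)
  from Cons.prems(6) obtain k w' where v: "v = k # w'"
    by (cases v) auto
  \<comment> \<open>The first step of the second word has minimal \<open>f\<close>-value, so in the
    first word it lies in the initial block, with the same letter \<open>k\<close>. Stated for
    arbitrary letters and words, so that it can be used in both directions.\<close>
  have le: "k \<le> i"
    if a: "strict_at_ascents f u (i # w)" and b: "strict_at_ascents f u (k # w')"
      and eq: "set (steps u (i # w)) = set (steps u (k # w'))" for i k w w'
  proof -
    have min: "f (steps u x ! 0) \<le> f z"
      if "strict_at_ascents f u x" "z \<in> set (steps u x)" for x z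
    proof -
      from that(2) obtain q where "q < length x" "z = steps u x ! q"
        by (auto simp: in_set_conv_nth)
      moreover from this have "0 < length x" by linarith
      ultimately show ?thesis using that(1) sorted_nth_mono[of "map f (steps u x)" 0 q]
        by (simp add: strict_at_ascents_def)
    qed
    let ?z = "(u k, u (Suc k))"
    have "?z \<in> set (steps u (i # w))" using eq by simp
    then obtain q where q: "q < length (i # w)" "?z = steps u (i # w) ! q"
      by (metis in_set_conv_nth length_steps)
    have "steps u (i # w) ! 0 \<in> set (steps u (k # w'))"
      unfolding eq[symmetric] by simp
    from min[OF b this] min[OF a \<open>?z \<in> set (steps u (i # w))\<close>]
    have "f (steps u (i # w) ! q) = f (steps u (i # w) ! 0)"
      unfolding q(2)[symmetric] by simp
    note level = fst_steps_level[OF a q(1) this]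
    have "u k = u ((i # w) ! q)" using level(1) q(2) by (metis fst_conv)
    then have "k = (i # w) ! q" using \<open>inj u\<close> by (simp add: inj_eq)
    then show ?thesis using level(2) by (cases "q = 0") auto
  qed
  have ik: "i = k"
    using le[OF Cons.prems(2) Cons.prems(3)[unfolded v] Cons.prems(6)[unfolded v]]
      le[OF Cons.prems(3)[unfolded v] Cons.prems(2) Cons.prems(6)[unfolded v, symmetric]]
    by simp
  \<comment> \<open>The first steps agree and, by distinctness, do not recur in the tails; they can
    be removed from both sets.\<close>
  have "set (steps (u \<circ> adj i) w) = set (steps (u \<circ> adj i) w')"
    using Cons.prems(4-6) unfolding v ik by (simp add: insert_ident del: o_apply)
  moreover have "inj (u \<circ> adj i)"
    by (rule inj_compose[OF \<open>inj u\<close>]) simp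
  ultimately have "w = w'"
    using Cons.IH[of "u \<circ> adj i" w'] Cons.prems(2-5) strict_at_ascents_Cons
    unfolding v ik by (simp del: o_apply)
  then show ?case using v ik by simp
qed

lemma Red_strict_at_ascents_iff:
  assumes \<sigma>: "\<sigma> permutes {1..n}" and w: "w \<in> Red n \<sigma>" and pos: "\<forall>z\<in>Inv n \<sigma>. 0 < f z"
  shows "map f (steps id w) \<in> compatible w \<longleftrightarrow> strict_at_ascents f id w"
proof -
  \<comment> \<open>Repeating a letter would undo the exchange just made, so one of the two steps
    would descend.\<close>
  have neq: "w ! j \<noteq> w ! Suc j" if j: "Suc j < length w" for j
  proof
    assume eq: "w ! j = w ! Suc j"
    define v where "v = id \<circ> word_perm (take j w)"
    have "drop j w = w ! j # w ! Suc j # drop (Suc (Suc j)) w"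
      using j by (simp add: Cons_nth_drop_Suc)
    then have "drop j (steps id w) =
      steps v (w ! j # w ! j # drop (Suc (Suc j)) w)"
      unfolding steps_drop v_def eq by simp
    moreover have "set (drop j (steps id w)) \<subseteq> set (steps id w)" by (rule set_drop_subset)
    ultimately have "{(v (w ! j), v (Suc (w ! j))), (v (Suc (w ! j)), v (w ! j))} \<subseteq> set (steps id w)"
      by simp
    moreover have "a < b" if "(a, b) \<in> set (steps id w)" for a b
      using w that unfolding Red_iff[OF \<sigma>] by blast
    ultimately have "v (w ! j) < v (Suc (w ! j)) \<and> v (Suc (w ! j)) < v (w ! j)" by blast
    then show False using less_asym by blast
  qed
  have "set (map f (steps id w)) \<subseteq> {0<..}"
    using pos Red_steps[OF \<sigma> w] by auto
  moreover have "(w ! j < w ! Suc j \<longrightarrow> map f (steps id w) ! j < map f (steps id w) ! Suc j) \<longleftrightarrow>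
      w ! Suc j < w ! j \<or> f (steps id w ! j) < f (steps id w ! Suc j)"
    if "Suc j < length w" for j
    using neq[OF that] that by auto
  ultimately show ?thesis
    unfolding compatible_def strict_at_ascents_def by simp
qed

section \<open>Existence of the word by exchanging commuting letters\<close>

lemma adj_commute: "Suc i < k \<Longrightarrow> adj i \<circ> adj k = adj k \<circ> adj i"
  by (auto simp: fun_eq_iff transpose_def)

text \<open>The larger letter moves one place to the left and the smaller one to the right, which
  lowers the sum by \<open>k - i\<close>.\<close>

lemma weighted_sum_swap_less:
  fixes i k :: nat
  assumes "i < k"
  shows "(\<Sum>j<length (x @ [k, i] @ y). j * (x @ [k, i] @ y) ! j)
    < (\<Sum>j<length (x @ [i, k] @ y). j * (x @ [i, k] @ y) ! j)"
proof -
  let ?l = "x @ [k, i] @ y" and ?r = "x @ [i, k] @ y" and ?p = "length x"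
  let ?S = "{..<length ?r} - {?p, Suc ?p}"
  have split: "(\<Sum>j<length ?r. j * z ! j) =
      ?p * z ! ?p + (Suc ?p * z ! Suc ?p + (\<Sum>j\<in>?S. j * z ! j))" for z :: "nat list"
    using sum.remove[of "{..<length ?r}" ?p "\<lambda>j. j * z ! j"]
      sum.remove[of "{..<length ?r} - {?p}" "Suc ?p" "\<lambda>j. j * z ! j"]
    unfolding Diff_insert2[of _ ?p "{Suc ?p}"] by auto
  have "(\<Sum>j\<in>?S. j * ?l ! j) = (\<Sum>j\<in>?S. j * ?r ! j)"
    by (intro sum.cong) (auto simp: nth_append nth_Cons split: nat.splits)
  then have "(\<Sum>j<length ?r. j * ?l ! j) < (\<Sum>j<length ?r. j * ?r ! j)"
    unfolding split using assms by (simp add: nth_append algebra_simps)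
  then show ?thesis by simp
qed

lemma ex_strict_at_ascents:
  assumes \<sigma>: "\<sigma> permutes {1..n}" and w0: "w0 \<in> Red n \<sigma>" "sorted (map f (steps id w0))"
    and ne: "\<And>z z'. z \<in> Inv n \<sigma> \<Longrightarrow> z' \<in> Inv n \<sigma> \<Longrightarrow> fst z = fst z' \<Longrightarrow> z \<noteq> z' \<Longrightarrow> f z \<noteq> f z'"
    and pos: "\<forall>z\<in>Inv n \<sigma>. 0 < f z"
  shows "\<exists>w\<in>Red n \<sigma>. strict_at_ascents f id w"
proof -
  \<comment> \<open>Exchanging an ascent of commuting letters decreases \<open>?M\<close>.\<close>
  let ?P = "\<lambda>w. w \<in> Red n \<sigma> \<and> sorted (map f (steps id w))"
  let ?M = "\<lambda>w. \<Sum>j<length w. j * w ! j"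
  \<comment> \<open>A minimiser of \<open>?M\<close> replaces the iteration of exchanges: an ascent
    with equal \<open>f\<close>-values would lead to a smaller sum.\<close>
  obtain w where w: "?P w" and least: "\<And>v. ?P v \<Longrightarrow> ?M w \<le> ?M v"
    using ex_has_least_nat[of ?P w0 ?M] w0 by blast
  have "f (steps id w ! j) < f (steps id w ! Suc j)"
    if j: "Suc j < length w" "w ! j < w ! Suc j" for j
  proof (rule ccontr)
    let ?i = "w ! j" and ?k = "w ! Suc j"
    define x y where "x = take j w" and "y = drop (Suc (Suc j)) w"
    define u where "u = id \<circ> word_perm x"
    assume "\<not> ?thesis"
    moreover have "f (steps id w ! j) \<le> f (steps id w ! Suc j)"
      using sorted_nth_mono[OF conjunct2[OF w], of j "Suc j"] j(1) by simp
    ultimately have eq: "f (steps id w ! j) = f (steps id w ! Suc j)" by simp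
    have w_eq: "w = x @ [?i, ?k] @ y"
      using j(1) by (simp add: x_def y_def Cons_nth_drop_Suc)
    have len: "length x = j" using j(1) by (simp add: x_def)
    have st: "steps id (x @ [a, b] @ y) = steps id x @
        [(u a, u (Suc a)), (u (adj a b), u (adj a (Suc b)))] @ steps (u \<circ> (adj a \<circ> adj b)) y" for a b
      by (simp add: steps_append u_def o_assoc)
    have nth: "steps id w ! j = (u ?i, u (Suc ?i))"
        "steps id w ! Suc j = (u (adj ?i ?k), u (adj ?i (Suc ?k)))"
      by (subst w_eq, subst st, simp add: nth_append len)+
    have mem: "steps id w ! j \<in> Inv n \<sigma>" "steps id w ! Suc j \<in> Inv n \<sigma>"
      using Red_steps[OF \<sigma>, of w] w j(1) nth_mem[of _ "steps id w"] by auto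
    have "steps id w ! j \<noteq> steps id w ! Suc j"
      using Red_steps[OF \<sigma>, of w] w j(1) by (simp add: nth_eq_iff_index_eq)
    \<comment> \<open>If \<open>?k = Suc ?i\<close>, then \<open>adj ?i\<close> sends
      \<open>?k\<close> to \<open>?i\<close>, and both steps have first coordinate
      \<open>u ?i\<close>.\<close>
    with ne[OF mem] eq have "?k \<noteq> Suc ?i" unfolding nth by auto
    with j(2) have far: "Suc ?i < ?k" by simp
    let ?v = "x @ [?k, ?i] @ y"
    have "steps id ?v = steps id x @ [steps id w ! Suc j, steps id w ! j] @
        steps (u \<circ> (adj ?i \<circ> adj ?k)) y"
      unfolding st nth adj_commute[OF far] using far by (simp add: transpose_def)
    moreover have "steps id w = steps id x @ [steps id w ! j, steps id w ! Suc j] @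
        steps (u \<circ> (adj ?i \<circ> adj ?k)) y"
      unfolding nth by (subst w_eq) (simp only: st)
    \<comment> \<open>The exchange swaps two neighbouring steps of equal \<open>f\<close>-value, so
      the list of values, and its sortedness, is unchanged.\<close>
    ultimately have "map f (steps id ?v) = map f (steps id w)"
      using eq by (metis (no_types, lifting) list.map(2) map_append)
    moreover have "?v \<in> Red n \<sigma>"
    proof -
      have "length ?v = length w" "set ?v = set w"
        using arg_cong[OF w_eq, of length] arg_cong[OF w_eq, of set] by auto
      moreover have "word_perm [?k, ?i] = word_perm [?i, ?k]"
        using adj_commute[OF far] by (simp del: o_apply)
      then have "word_perm ?v = word_perm (x @ [?i, ?k] @ y)"
        by (simp only: word_perm_append)
      then have "word_perm ?v = word_perm w"
        unfolding w_eq[symmetric] .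
      ultimately show ?thesis
        using w unfolding Red_def words_of_def mem_Collect_eq by metis
    qed
    ultimately have "?P ?v" using w by simp
    from least[OF this] weighted_sum_swap_less[OF j(2), of x y] show False
      by (simp only: w_eq[symmetric])
  qed
  then have "map f (steps id w) \<in> compatible w"
    using w pos Red_steps[OF \<sigma>, of w] by (auto simp: compatible_def)
  with w show ?thesis
    using Red_strict_at_ascents_iff[OF \<sigma> _ pos] by blast
qed

section \<open>Semistandard functions and the bijection\<close>

text \<open>Among inversions, membership in \<open>U_col\<close> just means equal first coordinates,
  a symmetric relation. Given weak monotonicity, strictness thus becomes inequality of values
  whatever the order of the steps, a condition independent of the chosen word.\<close>

lemma semistandard_digraph_A_iff:
  assumes \<sigma>: "\<sigma> permutes {1..n}"
  shows "semistandard (digraph_A n) (U_col n) (Inv n \<sigma>) f \<longleftrightarrow>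
    f \<in> Inv n \<sigma> \<rightarrow>\<^sub>E {0<..} \<and> (\<exists>w\<in>Red n \<sigma>. sorted (map f (steps id w))) \<and>
    (\<forall>z\<in>Inv n \<sigma>. \<forall>z'\<in>Inv n \<sigma>. z \<noteq> z' \<longrightarrow> fst z = fst z' \<longrightarrow> f z \<noteq> f z')"
proof -
  define Q where "Q zs \<longleftrightarrow> (\<forall>i j. i < j \<longrightarrow> j < length zs \<longrightarrow>
      f (zs ! i) \<le> f (zs ! j) \<and> (zs ! j \<in> U_col n (zs ! i) \<longrightarrow> f (zs ! i) < f (zs ! j)))" for zs
  define N where "N \<longleftrightarrow> (\<forall>z\<in>Inv n \<sigma>. \<forall>z'\<in>Inv n \<sigma>. z \<noteq> z' \<longrightarrow> fst z = fst z' \<longrightarrow> f z \<noteq> f z')"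
  have U: "z' \<in> U_col n z \<longleftrightarrow> fst z = fst z'" if "z' \<in> Inv n \<sigma>" for z z'
    using that by (cases z; cases z') (auto simp: U_col_def Inv_def)
  have "Q zs \<longleftrightarrow> sorted (map f zs) \<and> N"
    if w: "w \<in> Red n \<sigma>" and zs: "zs = steps id w" for w zs
  proof
    note set = Red_steps[OF \<sigma> w, folded zs]
    show "sorted (map f zs) \<and> N" if A: "Q zs"
      unfolding N_def
    proof (intro conjI ballI impI)
      show "sorted (map f zs)" using A by (simp add: Q_def sorted_iff_nth_mono_less)
      fix z z' assume "z \<in> Inv n \<sigma>" "z' \<in> Inv n \<sigma>" "z \<noteq> z'" "fst z = fst z'"
      then obtain i j where ij: "i < length zs" "j < length zs" "z = zs ! i" "z' = zs ! j"
        unfolding set(2)[symmetric] in_set_conv_nth by metis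
      with \<open>z \<noteq> z'\<close> consider "i < j" | "j < i" by (metis linorder_neqE_nat)
      then show "f z \<noteq> f z'"
      proof cases
        case 1
        with A[unfolded Q_def] ij U[OF \<open>z' \<in> Inv n \<sigma>\<close>, of z] \<open>fst z = fst z'\<close> show ?thesis by fastforce
      next
        case 2
        with A[unfolded Q_def] ij U[OF \<open>z \<in> Inv n \<sigma>\<close>, of z'] \<open>fst z = fst z'\<close> show ?thesis by fastforce
      qed
    qed
    show "Q zs" if B: "sorted (map f zs) \<and> N"
      unfolding Q_def
    proof (intro allI impI conjI)
      fix i j assume ij: "i < j" "j < length zs"
      then show le: "f (zs ! i) \<le> f (zs ! j)"
        using sorted_nth_mono[OF conjunct1[OF B], of i j] by simp
      assume "zs ! j \<in> U_col n (zs ! i)"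
      moreover have mem: "zs ! i \<in> Inv n \<sigma>" "zs ! j \<in> Inv n \<sigma>" "zs ! i \<noteq> zs ! j"
        using ij set nth_mem[of i zs] nth_mem[of j zs] nth_eq_iff_index_eq[OF set(1), of i j] by auto
      ultimately have "f (zs ! i) \<noteq> f (zs ! j)"
        using B[unfolded N_def] U by blast
      with le show "f (zs ! i) < f (zs ! j)" by simp
    qed
  qed
  then have "(\<exists>zs\<in>steps id ` Red n \<sigma>. Q zs) \<longleftrightarrow>
      (\<exists>w\<in>Red n \<sigma>. sorted (map f (steps id w))) \<and> N" by blast
  then show ?thesis
    unfolding semistandard_def PS_digraph_A[OF \<sigma>] Q_def[symmetric] N_def[symmetric] by (simp only:)
qed

text \<open>Drop the letters before the earlier of the two steps. If the values were equal, both
  first coordinates would be images of different letters under one injective map, by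
  \<open>fst_steps_level\<close>.\<close>

lemma strict_at_ascents_imp_neq:
  assumes \<sigma>: "\<sigma> permutes {1..n}" and w: "w \<in> Red n \<sigma>" and good: "strict_at_ascents f id w"
    and z: "z \<in> Inv n \<sigma>" "z' \<in> Inv n \<sigma>" "z \<noteq> z'" "fst z = fst z'"
  shows "f z \<noteq> f z'"
proof
  assume eq: "f z = f z'"
  let ?s = "steps id w"
  have False if pq: "p < q" "q < length w" "f (?s ! p) = f (?s ! q)" "fst (?s ! p) = fst (?s ! q)"
    for p q
  proof -
    let ?u = "id \<circ> word_perm (take p w)" and ?w = "drop p w"
    note level = fst_steps_level[OF strict_at_ascents_drop[OF good, of p]]
    have s: "steps ?u ?w ! j = ?s ! (p + j)" for j
      using pq unfolding steps_drop[symmetric] by simp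
    have "fst (?s ! p) = ?u (?w ! 0)" "fst (?s ! q) = ?u (?w ! (q - p))"
      using level(1)[of 0] level(1)[of "q - p"] pq unfolding s by simp_all
    moreover have "?w ! (q - p) < ?w ! 0"
      using level(2)[of "q - p"] pq unfolding s by simp
    moreover have "inj ?u"
      using w permutes_inj[OF word_perm_permutes, of "take p w" n] set_take_subset[of p w]
      unfolding Red_iff[OF \<sigma>] by auto
    ultimately show False using pq(4) by (metis inj_eq less_irrefl)
  qed
  moreover obtain p q where "p < length w" "q < length w" "z = ?s ! p" "z' = ?s ! q"
    using z(1,2) unfolding Red_steps(2)[OF \<sigma> w, symmetric] in_set_conv_nth length_steps by metis
  ultimately show False using eq z(3,4) by (metis linorder_neqE_nat)
qed

lemma bij_betw_semistandard:
  assumes \<sigma>: "\<sigma> permutes {1..n}"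
  shows "bij_betw (\<lambda>(w, r). restrict (the \<circ> map_of (zip (steps id w) r)) (Inv n \<sigma>))
    (SIGMA w:Red n \<sigma>. compatible w) {f. semistandard (digraph_A n) (U_col n) (Inv n \<sigma>) f}"
    (is "bij_betw ?G ?P ?F")
proof -
  \<comment> \<open>The steps of a reduced word are distinct, so looking up the \<open>j\<close>-th
    step returns \<open>r ! j\<close>.\<close>
  have map_G: "map (?G (w, r)) (steps id w) = r" if "w \<in> Red n \<sigma>" "length r = length w" for w r
  proof (rule nth_equalityI)
    fix j assume "j < length (map (?G (w, r)) (steps id w))"
    with that Red_steps[OF \<sigma> that(1)] nth_mem[of j "steps id w"]
    show "map (?G (w, r)) (steps id w) ! j = r ! j"
      by (simp add: map_of_zip_nth)
  qed (simp add: that)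
  have G: "strict_at_ascents (?G (w, r)) id w \<and> (\<forall>z\<in>Inv n \<sigma>. 0 < ?G (w, r) z)
      \<and> map (?G (w, r)) (steps id w) = r"
    if "w \<in> Red n \<sigma>" "r \<in> compatible w" for w r
  proof -
    have m: "map (?G (w, r)) (steps id w) = r"
      using that by (intro map_G) (auto simp: compatible_def)
    have pos: "\<forall>z\<in>Inv n \<sigma>. 0 < ?G (w, r) z"
    proof
      fix z assume "z \<in> Inv n \<sigma>"
      then have "?G (w, r) z \<in> set (map (?G (w, r)) (steps id w))"
        using Red_steps[OF \<sigma> that(1)] by simp
      then have "?G (w, r) z \<in> set r" unfolding m .
      then show "0 < ?G (w, r) z" using that(2) unfolding compatible_def by blast
    qed
    from Red_strict_at_ascents_iff[OF \<sigma> that(1) pos] m pos that(2) show ?thesis by metis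
  qed
  show ?thesis
    unfolding bij_betw_def
  proof (intro conjI inj_onI subset_antisym subsetI)
    fix x y assume xy: "x \<in> ?P" "y \<in> ?P" "?G x = ?G y"
    then obtain w r w' r' where x: "x = (w, r)" and y: "y = (w', r')"
      and wr: "w \<in> Red n \<sigma>" "r \<in> compatible w" "w' \<in> Red n \<sigma>" "r' \<in> compatible w'" by auto
    \<comment> \<open>Both words are now related to one and the same function. Uniqueness gives
      equal words, and each sequence is the list of values on the steps.\<close>
    note G1 = G[OF wr(1,2)] and G2 = G[OF wr(3,4), folded y, folded xy(3), unfolded x]
    have "w = w'"
      using strict_at_ascents_unique[OF inj_on_id, of "?G (w, r)" w w'] G1 G2
        Red_steps[OF \<sigma> wr(1)] Red_steps[OF \<sigma> wr(3)] by metis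
    then show "x = y" using G1 G2 x y by metis
  next
    fix f assume "f \<in> ?G ` ?P"
    then obtain w r where f: "f = ?G (w, r)" and wr: "w \<in> Red n \<sigma>" "r \<in> compatible w" by auto
    note G' = G[OF wr, folded f]
    have "f \<in> Inv n \<sigma> \<rightarrow>\<^sub>E {0<..}"
      using G' unfolding f by (auto simp: PiE_def)
    moreover have "sorted (map f (steps id w))"
      using G' unfolding strict_at_ascents_def by blast
    ultimately show "f \<in> ?F"
      using strict_at_ascents_imp_neq[OF \<sigma> wr(1)] G' wr(1)
      unfolding mem_Collect_eq semistandard_digraph_A_iff[OF \<sigma>] by blast
  next
    fix f assume "f \<in> ?F"
    note ss = this[unfolded mem_Collect_eq semistandard_digraph_A_iff[OF \<sigma>]]
    then have pos: "\<forall>z\<in>Inv n \<sigma>. 0 < f z" by auto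
    from ss obtain w0 where "w0 \<in> Red n \<sigma>" "sorted (map f (steps id w0))" by blast
    from ex_strict_at_ascents[OF \<sigma> this _ pos] ss
    obtain w where w: "w \<in> Red n \<sigma>" "strict_at_ascents f id w" by blast
    define r where "r = map f (steps id w)"
    have r: "r \<in> compatible w"
      using Red_strict_at_ascents_iff[OF \<sigma> w(1) pos] w(2) by (simp add: r_def)
    have "f z = ?G (w, r) z" for z
    proof (cases "z \<in> Inv n \<sigma>")
      case True
      have "map (?G (w, r)) (steps id w) = map f (steps id w)"
        using G[OF w(1) r] by (simp add: r_def)
      with True show ?thesis
        unfolding Red_steps(2)[OF \<sigma> w(1), symmetric] map_eq_conv by metis
    next
      case False
      with PiE_arb[OF conjunct1[OF ss]] show ?thesis by simp
    qed
    then have "f = ?G (w, r)" by blast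
    with w(1) r show "f \<in> ?G ` ?P" by blast
  qed
qed

section \<open>Comparison of coefficients\<close>

lemma prod_X_restrict_map_of:
  assumes \<sigma>: "\<sigma> permutes {1..n}" and w: "w \<in> Red n \<sigma>" and r: "length r = length w"
  shows "(\<Prod>z\<in>Inv n \<sigma>. X (restrict (the \<circ> map_of (zip (steps id w) r)) (Inv n \<sigma>) z))
    = (\<Prod>j<length w. X (r ! j))"
proof (rule prod.reindex_bij_betw[symmetric, where h = "\<lambda>j. steps id w ! j", THEN trans])
  note s = Red_steps[OF \<sigma> w]
  show "bij_betw (\<lambda>j. steps id w ! j) {..<length w} (Inv n \<sigma>)"
    using bij_betw_nth[OF s(1)] s(2) by simp
  show "(\<Prod>j<length w. X (restrict (the \<circ> map_of (zip (steps id w) r)) (Inv n \<sigma>) (steps id w ! j)))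
    = (\<Prod>j<length w. X (r ! j))"
  proof (rule prod.cong[OF refl])
    fix j assume "j \<in> {..<length w}"
    then have "j < length (steps id w)" by simp
    then show "X (restrict (the \<circ> map_of (zip (steps id w) r)) (Inv n \<sigma>) (steps id w ! j)) = X (r ! j)"
      using s nth_mem[of j "steps id w"] r by (simp add: map_of_zip_nth)
  qed
qed

theorem theorem6:
  fixes n :: nat and \<sigma> :: "nat \<Rightarrow> nat"
  assumes "n \<ge> 2" and "\<sigma> permutes {1..n}"
  shows "Gamma_series (digraph_A n) (U_col n) (Inv n \<sigma>) = stanley n \<sigma>"
proof
  fix m
  let ?G = "\<lambda>(w, r). restrict (the \<circ> map_of (zip (steps id w) r)) (Inv n \<sigma>)"
  let ?F = "{f. semistandard (digraph_A n) (U_col n) (Inv n \<sigma>) f}"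
  let ?c = "\<lambda>f. Poly_Mapping.lookup (\<Prod>z\<in>Inv n \<sigma>. X (f z)) m"
  let ?d = "\<lambda>w r. Poly_Mapping.lookup (\<Prod>j<length w. X (r ! j)) m"
  let ?C = "\<lambda>w. {r \<in> compatible w. ?d w r \<noteq> 0}"
  have cd: "?c (?G (w, r)) = ?d w r" if "w \<in> Red n \<sigma>" "r \<in> compatible w" for w r
    using prod_X_restrict_map_of[OF assms(2) that(1), of r] that(2) by (simp add: compatible_def)
  have bij: "bij_betw ?G (SIGMA w:Red n \<sigma>. compatible w) ?F"
    by (rule bij_betw_semistandard[OF assms(2)])
  \<comment> \<open>\<open>formal_sum\<close> adds only nonzero contributions, so the bijection is
    restricted to the indices whose monomial is \<open>m\<close>.\<close>
  have "bij_betw ?G (SIGMA w:Red n \<sigma>. ?C w) {f \<in> ?F. ?c f \<noteq> 0}"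
  proof (rule bij_betw_subset[OF bij])
    show "?G ` (SIGMA w:Red n \<sigma>. ?C w) = {f \<in> ?F. ?c f \<noteq> 0}" (is "?I = ?K")
    proof (intro subset_antisym subsetI)
      fix f assume "f \<in> ?I"
      then obtain w r where wr: "f = ?G (w, r)" "w \<in> Red n \<sigma>" "r \<in> compatible w"
        and "?d w r \<noteq> 0" by blast
      then have "f \<in> ?F" using bij_betw_imp_surj_on[OF bij] by blast
      moreover have "?c f \<noteq> 0" using cd[OF wr(2,3)] wr(1) \<open>?d w r \<noteq> 0\<close> by simp
      ultimately show "f \<in> ?K" by blast
    next
      fix f assume f: "f \<in> ?K"
      then have "f \<in> ?G ` (SIGMA w:Red n \<sigma>. compatible w)"
        using bij_betw_imp_surj_on[OF bij] by blast
      then obtain w r where wr: "f = ?G (w, r)" "w \<in> Red n \<sigma>" "r \<in> compatible w" by blast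
      with f cd[OF wr(2,3)] have "?d w r \<noteq> 0" by simp
      with wr show "f \<in> ?I" by blast
    qed
  qed blast
  have "stanley n \<sigma> m = (\<Sum>w\<in>Red n \<sigma>. \<Sum>r\<in>?C w. ?d w r)"
    by (simp add: stanley_def formal_sum_def)
  \<comment> \<open>Merging the two sums requires finite index sets, hence the restriction to
    nonzero coefficients: \<open>compatible w\<close> itself may be infinite.\<close>
  also have "\<dots> = (\<Sum>(w, r)\<in>(SIGMA w:Red n \<sigma>. ?C w). ?d w r)"
    by (rule sum.Sigma) (simp_all add: finite_Red finite_compatible_terms)
  also have "\<dots> = (\<Sum>x\<in>(SIGMA w:Red n \<sigma>. ?C w). ?c (?G x))"
    by (rule sum.cong) (auto simp only: cd[unfolded prod.case] mem_Sigma_iff mem_Collect_eq split: prod.split)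
  also have "\<dots> = (\<Sum>f\<in>{f \<in> ?F. ?c f \<noteq> 0}. ?c f)"
    by (rule sum.reindex_bij_betw) fact
  finally show "Gamma_series (digraph_A n) (U_col n) (Inv n \<sigma>) m = stanley n \<sigma> m"
    by (simp only: Gamma_series_def formal_sum_def)
qed

end
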